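(* Let $N\in\mathbb{N}$, $N\geq 1$, let $r_1>r_2>\dots>r_N>0$, and put $t^i_j=(r_j/r_i)^3$ for $i,j=1,\dots,N$. Define the polynomial $$f_N(q)=\sum_{k=0}^{\lfloor N/2\rfloor} 2^k q^{\lfloor N/2\rfloor-k}\Big(\sum_{\mathbf{i}_{2k}\in C_{N}^{0,2k}}\tau_{\mathbf{i}_{2k}}\prod_{l=1}^k t^{i_{2l-1}}_{i_{2l}}\Big).$$ Then $f_N$ has $\lfloor N/2\rfloor$ real roots (counted with multiplicity). Moreover, every root $q^*$ of $f_N$ satisfies $$q^*\in[-1/4,\,2].$$
   Context: $\lfloor t\rfloor$ denotes the integer part of $t$. $C_N^{0,m}$ denotes the set of all combinations of $m$ elements out of $\{1,\dots,N\}$, each written as a multi-index $\mathbf{i}_m=(i_1,\dots,i_m)$ in increasing order, $1\le i_1<i_2<\dots<i_m\le N$. The sign of a multi-index is $\tau_{\mathbf{i}_m}=(-1)^{i_1+i_2+\dots+i_m}$. For $m=0$ the only combination is the empty one, so the inner sum for $k=0$ equals $1$. *)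

theory Defs
  imports Complex_Main "HOL-Computational_Algebra.Polynomial"
begin

definition combinations :: "nat \<Rightarrow> nat \<Rightarrow> nat list set" where
  "combinations N m = {is. length is = m \<and> sorted_wrt (<) is \<and> set is \<subseteq> {1..N}}"

definition tau :: "nat list \<Rightarrow> real" where
  "tau is = (- 1) ^ sum_list is"

definition tratio :: "(nat \<Rightarrow> real) \<Rightarrow> nat \<Rightarrow> nat \<Rightarrow> real" where
  "tratio r i j = (r j / r i) ^ 3"

text \<open>Lists are indexed from 0, so the entry \<open>i\<^sub>m\<close> of a multi-index is \<open>is ! (m - 1)\<close>.\<close>

definition f_coeff :: "(nat \<Rightarrow> real) \<Rightarrow> nat \<Rightarrow> nat \<Rightarrow> real" where
  "f_coeff r N k =
     (\<Sum>is\<in>combinations N (2 * k).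
        tau is * (\<Prod>l=1..k. tratio r (is ! (2 * l - 1 - 1)) (is ! (2 * l - 1))))"

definition f_poly :: "(nat \<Rightarrow> real) \<Rightarrow> nat \<Rightarrow> real poly" where
  "f_poly r N = (\<Sum>k=0..N div 2. monom (2 ^ k * f_coeff r N k) (N div 2 - k))"

end

theory Submission
  imports Defs "HOL-Computational_Algebra.Fundamental_Theorem_Algebra"
begin

text \<open>
  For \<open>q \<noteq> 0\<close> put \<open>y = 2 / q\<close>. Then \<open>f\<^sub>N(q) = q\<^bsup>\<lfloor>N/2\<rfloor>\<^esup> E\<^sub>N(y)\<close>, where \<open>E\<^sub>N(y)\<close> is the
  generating function of the coefficients \<open>f_coeff r N k\<close>. Write \<open>s\<^sub>i = r\<^sub>i\<^sup>3\<close>, so that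
  \<open>t\<^sup>i\<^sub>j = s\<^sub>j / s\<^sub>i\<close> splits into a contribution of \<open>i\<close> and one of \<open>j\<close>. A combination of even size is
  then built by reading the indices from left to right: a chosen index either opens a pair
  (weight \<open>1 / s\<^sub>i\<close>) or closes one (weight \<open>s\<^sub>i\<close>). With \<open>O\<^sub>N\<close> the generating function of the
  combinations with one open pair, and \<open>\<epsilon>\<^sub>N = (-1)\<^bsup>N\<^esup>\<close>, this is the transfer recursion
  \<open>E\<^sub>N\<^sub>+\<^sub>1 = E\<^sub>N + \<epsilon>\<^sub>N\<^sub>+\<^sub>1 s\<^sub>N\<^sub>+\<^sub>1 y O\<^sub>N\<close> and \<open>O\<^sub>N\<^sub>+\<^sub>1 = O\<^sub>N + \<epsilon>\<^sub>N\<^sub>+\<^sub>1 E\<^sub>N / s\<^sub>N\<^sub>+\<^sub>1\<close>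
  (\<open>even_sum_Suc\<close>, \<open>odd_sum_Suc\<close>).

  The ratio \<open>\<zeta>\<^sub>N = E\<^sub>N / (\<epsilon>\<^sub>N s\<^sub>N O\<^sub>N)\<close> starts at \<open>\<zeta>\<^sub>1 = 1\<close>. With \<open>\<sigma> = s\<^sub>N\<^sub>+\<^sub>1 / s\<^sub>N\<close> it evolves by
  \<open>\<zeta>\<^sub>N\<^sub>+\<^sub>1 = (\<zeta>\<^sub>N - \<sigma> y) / (\<zeta>\<^sub>N - \<sigma>) = 1 + \<sigma> (1 - y) / (\<zeta>\<^sub>N - \<sigma>)\<close>, and \<open>0 < \<sigma> < 1\<close> because \<open>r\<close>
  decreases. Fix \<open>y\<close> outside the ray \<open>(1, \<infinity>)\<close> and put \<open>m = 1 - y\<close>. The set \<open>1 + C\<close>, where \<open>C\<close> is the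
  convex cone spanned by \<open>1\<close> and \<open>m\<close>, is invariant: if \<open>\<zeta>\<^sub>N = 1 + w\<close> with \<open>w \<in> C\<close>, then
  \<open>\<zeta>\<^sub>N - \<sigma> = (1 - \<sigma>) + w\<close> is a nonzero element of \<open>C\<close>, and dividing \<open>m\<close> by a nonzero element of \<open>C\<close>
  leads back into \<open>C\<close> (\<open>cone_inversion\<close>). As \<open>m\<close> is not a negative real, \<open>0\<close> does not lie in \<open>1 + C\<close>,
  and so \<open>E\<^sub>N(y) \<noteq> 0\<close> (\<open>even_sum_in_cone\<close>, \<open>pos_plus_cone_nonzero\<close>).

  Hence every complex root \<open>q \<noteq> 0\<close> of \<open>f\<^sub>N\<close> has \<open>2 / q\<close> real and greater than \<open>1\<close>: all complex roots
  are real and lie in \<open>[0, 2)\<close> (\<open>f_poly_complex_root\<close>), which is sharper than the claimed interval.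
  A real polynomial with only real complex roots has as many real roots as its degree
  (\<open>size_proots_eq_degree\<close>), and \<open>f\<^sub>N\<close> is monic of degree \<open>\<lfloor>N/2\<rfloor>\<close>.
\<close>

section \<open>Recursion over the largest index\<close>

lemma finite_combinations: "finite (combinations N m)"
  by (rule finite_subset[OF _ finite_lists_length_eq[of "{1..N}" m]])
     (auto simp: combinations_def)

lemma combinations_0: "combinations N 0 = {[]}"
  by (auto simp: combinations_def)

lemma combinations_eq_empty:
  assumes "N < m"
  shows "combinations N m = {}"
proof -
  have "length is \<le> N" if "sorted_wrt (<) is" "set is \<subseteq> {1..N}" for "is" :: "nat list"
    using card_mono[OF _ that(2)] distinct_card[of "is"] that(1)
    by (simp add: strict_sorted_iff)
  with assms show ?thesis
    by (fastforce simp: combinations_def)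
qed

lemma combinations_Suc_Suc:
  "combinations (Suc N) (Suc m) =
     combinations N (Suc m) \<union> (\<lambda>is. is @ [Suc N]) ` combinations N m"
proof (intro equalityI subsetI)
  fix js
  assume js: "js \<in> combinations (Suc N) (Suc m)"
  then obtain "is" j where js_eq: "js = is @ [j]"
    by (cases js rule: rev_cases) (auto simp: combinations_def)
  have bound: "i < j" if "i \<in> set is" for i
    using js that by (auto simp: combinations_def js_eq sorted_wrt_append)
  show "js \<in> combinations N (Suc m) \<union> (\<lambda>is. is @ [Suc N]) ` combinations N m"
  proof (cases "j = Suc N")
    case True
    with js bound have "is \<in> combinations N m"
      by (fastforce simp: combinations_def js_eq sorted_wrt_append)
    with True show ?thesis by (auto simp: js_eq)
  next
    case False
    with js bound have "js \<in> combinations N (Suc m)"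
      by (fastforce simp: combinations_def js_eq sorted_wrt_append)
    then show ?thesis ..
  qed
qed (fastforce simp: combinations_def sorted_wrt_append)+

lemma sum_combinations_Suc_Suc:
  "sum F (combinations (Suc N) (Suc m)) =
     sum F (combinations N (Suc m)) + (\<Sum>is\<in>combinations N m. F (is @ [Suc N]))"
proof -
  have "combinations N (Suc m) \<inter> (\<lambda>is. is @ [Suc N]) ` combinations N m = {}"
    by (auto simp: combinations_def)
  moreover have "inj_on (\<lambda>is. is @ [Suc N]) (combinations N m)"
    by (auto simp: inj_on_def)
  ultimately show ?thesis
    by (simp add: combinations_Suc_Suc sum.union_disjoint finite_combinations sum.reindex)
qed

text \<open>The numerator \<open>r j ^ 3\<close> of a ratio \<open>tratio r i j\<close> is only known once the pair is completed.
  A combination of odd size therefore carries the factor \<open>1 / r i ^ 3\<close> of its last, still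
  unpaired, index \<open>i\<close>.\<close>

definition odd_coeff :: "(nat \<Rightarrow> real) \<Rightarrow> nat \<Rightarrow> nat \<Rightarrow> real" where
  "odd_coeff r N k =
     (\<Sum>is\<in>combinations N (2 * k + 1).
        tau is * (\<Prod>l=1..k. tratio r (is ! (2 * l - 1 - 1)) (is ! (2 * l - 1)))
          / r (is ! (2 * k)) ^ 3)"

lemma f_coeff_0: "f_coeff r N 0 = 1"
  by (simp add: f_coeff_def combinations_0 tau_def)

lemma odd_coeff_eq_0: "N \<le> 2 * k \<Longrightarrow> odd_coeff r N k = 0"
  by (simp add: odd_coeff_def combinations_eq_empty)

lemma f_coeff_Suc_Suc:
  "f_coeff r (Suc N) (Suc k) =
     f_coeff r N (Suc k) + (- 1) ^ Suc N * r (Suc N) ^ 3 * odd_coeff r N k"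
proof -
  have "tau (is @ [Suc N]) *
          (\<Prod>l=1..Suc k. tratio r ((is @ [Suc N]) ! (2 * l - 1 - 1)) ((is @ [Suc N]) ! (2 * l - 1)))
        = (- 1) ^ Suc N * r (Suc N) ^ 3 *
          (tau is * (\<Prod>l=1..k. tratio r (is ! (2 * l - 1 - 1)) (is ! (2 * l - 1)))
            / r (is ! (2 * k)) ^ 3)"
    if "is \<in> combinations N (2 * k + 1)" for "is"
  proof -
    have len: "length is = 2 * k + 1"
      using that by (simp add: combinations_def)
    have "(\<Prod>l=1..k. tratio r ((is @ [Suc N]) ! (2 * l - 1 - 1)) ((is @ [Suc N]) ! (2 * l - 1)))
        = (\<Prod>l=1..k. tratio r (is ! (2 * l - 1 - 1)) (is ! (2 * l - 1)))"
      by (rule prod.cong) (auto simp: nth_append len)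
    moreover have "(is @ [Suc N]) ! (2 * k) = is ! (2 * k)" "(is @ [Suc N]) ! (2 * k + 1) = Suc N"
      by (auto simp: nth_append len)
    ultimately show ?thesis
      by (simp add: tau_def tratio_def power_add power_divide)
  qed
  note last_index = this
  have "f_coeff r (Suc N) (Suc k) = f_coeff r N (Suc k) +
      (\<Sum>is\<in>combinations N (2 * k + 1). tau (is @ [Suc N]) *
          (\<Prod>l=1..Suc k. tratio r ((is @ [Suc N]) ! (2 * l - 1 - 1)) ((is @ [Suc N]) ! (2 * l - 1))))"
    (is "_ = _ + ?S")
    using sum_combinations_Suc_Suc[of
        "\<lambda>is. tau is * (\<Prod>l=1..Suc k. tratio r (is ! (2 * l - 1 - 1)) (is ! (2 * l - 1)))" N "2 * k + 1"]
    by (simp only: f_coeff_def mult_Suc_right add_2_eq_Suc Suc_eq_plus1[symmetric])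
  also have "?S = (- 1) ^ Suc N * r (Suc N) ^ 3 * odd_coeff r N k"
    unfolding odd_coeff_def sum_distrib_left by (rule sum.cong[OF refl]) (rule last_index)
  finally show ?thesis .
qed

lemma odd_coeff_Suc:
  "odd_coeff r (Suc N) k = odd_coeff r N k + (- 1) ^ Suc N / r (Suc N) ^ 3 * f_coeff r N k"
proof -
  have "tau (is @ [Suc N]) *
          (\<Prod>l=1..k. tratio r ((is @ [Suc N]) ! (2 * l - 1 - 1)) ((is @ [Suc N]) ! (2 * l - 1)))
          / r ((is @ [Suc N]) ! (2 * k)) ^ 3
        = (- 1) ^ Suc N / r (Suc N) ^ 3 *
          (tau is * (\<Prod>l=1..k. tratio r (is ! (2 * l - 1 - 1)) (is ! (2 * l - 1))))"
    if "is \<in> combinations N (2 * k)" for "is"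
  proof -
    have len: "length is = 2 * k"
      using that by (simp add: combinations_def)
    have "(\<Prod>l=1..k. tratio r ((is @ [Suc N]) ! (2 * l - 1 - 1)) ((is @ [Suc N]) ! (2 * l - 1)))
        = (\<Prod>l=1..k. tratio r (is ! (2 * l - 1 - 1)) (is ! (2 * l - 1)))"
      by (rule prod.cong) (auto simp: nth_append len)
    moreover have "(is @ [Suc N]) ! (2 * k) = Suc N"
      by (auto simp: nth_append len)
    ultimately show ?thesis
      by (simp add: tau_def power_add)
  qed
  note last_index = this
  have "odd_coeff r (Suc N) k = odd_coeff r N k +
      (\<Sum>is\<in>combinations N (2 * k). tau (is @ [Suc N]) *
          (\<Prod>l=1..k. tratio r ((is @ [Suc N]) ! (2 * l - 1 - 1)) ((is @ [Suc N]) ! (2 * l - 1)))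
          / r ((is @ [Suc N]) ! (2 * k)) ^ 3)"
    (is "_ = _ + ?S")
    using sum_combinations_Suc_Suc[of
        "\<lambda>is. tau is * (\<Prod>l=1..k. tratio r (is ! (2 * l - 1 - 1)) (is ! (2 * l - 1)))
              / r (is ! (2 * k)) ^ 3" N "2 * k"]
    by (simp only: odd_coeff_def Suc_eq_plus1[symmetric])
  also have "?S = (- 1) ^ Suc N / r (Suc N) ^ 3 * f_coeff r N k"
    unfolding f_coeff_def sum_distrib_left by (rule sum.cong[OF refl]) (rule last_index)
  finally show ?thesis .
qed

text \<open>Both sums are cut off at the same \<open>K\<close>, which stays fixed while \<open>N\<close> grows, so that the recursion relates
  sums over equal ranges. The last term of the odd sum must vanish for this to be exact, hence the
  bound \<open>N \<le> 2 * K\<close> in \<open>even_sum_Suc\<close>.\<close>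

definition even_sum :: "(nat \<Rightarrow> real) \<Rightarrow> nat \<Rightarrow> complex \<Rightarrow> nat \<Rightarrow> complex" where
  "even_sum r K y N = (\<Sum>k\<le>K. of_real (f_coeff r N k) * y ^ k)"

definition odd_sum :: "(nat \<Rightarrow> real) \<Rightarrow> nat \<Rightarrow> complex \<Rightarrow> nat \<Rightarrow> complex" where
  "odd_sum r K y N = (\<Sum>k\<le>K. of_real (odd_coeff r N k) * y ^ k)"

lemma even_sum_Suc:
  assumes "N \<le> 2 * K"
  shows "even_sum r K y (Suc N) =
           even_sum r K y N + (- 1) ^ Suc N * of_real (r (Suc N) ^ 3) * y * odd_sum r K y N"
proof -
  have "even_sum r K y (Suc N) =
      1 + (\<Sum>k<K. of_real (f_coeff r (Suc N) (Suc k)) * y ^ Suc k)"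
    by (simp add: even_sum_def lessThan_Suc_atMost[symmetric] sum.lessThan_Suc_shift f_coeff_0
             del: sum.lessThan_Suc)
  also have "\<dots> = 1 + (\<Sum>k<K. of_real (f_coeff r N (Suc k)) * y ^ Suc k) +
      (- 1) ^ Suc N * of_real (r (Suc N) ^ 3) * y * (\<Sum>k<K. of_real (odd_coeff r N k) * y ^ k)"
    by (simp add: f_coeff_Suc_Suc sum.distrib sum_distrib_left algebra_simps
                  sum_negf sum_subtractf)
  also have "1 + (\<Sum>k<K. of_real (f_coeff r N (Suc k)) * y ^ Suc k) = even_sum r K y N"
    by (simp add: even_sum_def lessThan_Suc_atMost[symmetric] sum.lessThan_Suc_shift f_coeff_0
             del: sum.lessThan_Suc)
  also have "(\<Sum>k<K. of_real (odd_coeff r N k) * y ^ k) = odd_sum r K y N"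
    using assms by (simp add: odd_sum_def lessThan_Suc_atMost[symmetric] odd_coeff_eq_0)
  finally show ?thesis .
qed

lemma odd_sum_Suc:
  "odd_sum r K y (Suc N) =
     odd_sum r K y N + (- 1) ^ Suc N / of_real (r (Suc N) ^ 3) * even_sum r K y N"
  by (simp add: odd_sum_def even_sum_def odd_coeff_Suc sum.distrib sum_distrib_left
                sum_divide_distrib algebra_simps sum_negf sum_subtractf)

lemma even_sum_0: "even_sum r K y 0 = 1"
proof -
  have "f_coeff r 0 k = (if k = 0 then 1 else 0)" for k
    by (simp add: f_coeff_0) (simp add: f_coeff_def combinations_eq_empty)
  then show ?thesis
    by (simp add: even_sum_def if_distrib[of of_real] if_distrib[of "\<lambda>c. c * _"] cong: if_cong)
qed

lemma odd_sum_0: "odd_sum r K y 0 = 0"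
  by (simp add: odd_sum_def odd_coeff_eq_0)


section \<open>An invariant cone\<close>

definition cone :: "complex \<Rightarrow> complex set" where
  "cone m = {of_real u + of_real v * m | u v. u \<ge> 0 \<and> v \<ge> 0}"

lemma cone_0: "0 \<in> cone m"
  unfolding cone_def by (rule CollectI, rule exI[of _ 0], rule exI[of _ 0]) simp

text \<open>A positive number can only be cancelled by a nonnegative multiple of \<open>m\<close> if \<open>m\<close> is a negative
  real, that is, if \<open>m\<close> points opposite to the other generator of the cone.\<close>

lemma pos_plus_cone_nonzero:
  assumes m: "\<not> (m \<in> \<real> \<and> Re m < 0)" and w: "w \<in> cone m" and "c > 0"
  shows "of_real c + w \<noteq> 0"
proof
  assume zero: "of_real c + w = 0"
  obtain u v where uv: "u \<ge> 0" "v \<ge> 0" and w_eq: "w = of_real u + of_real v * m"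
    using w by (auto simp: cone_def)
  from zero have re: "c + u + v * Re m = 0" and im: "v * Im m = 0"
    by (auto simp: w_eq complex_eq_iff)
  from re uv \<open>c > 0\<close> have "v * Re m < 0" by linarith
  with uv have "v \<noteq> 0" "Re m < 0" by (auto simp: mult_less_0_iff)
  with im m show False by (simp add: complex_is_Real_iff)
qed

text \<open>Dividing by \<open>d\<close> is multiplying by \<open>cnj d\<close> up to a positive factor, and conjugation exchanges the
  two generators after multiplication by \<open>m\<close>: \<open>m * cnj 1 = m\<close> and \<open>m * cnj m = \<bar>m\<bar>\<^sup>2\<close>.\<close>

lemma cone_inversion:
  assumes w: "w \<in> cone m" and "c > 0" and "\<sigma> > 0"
  shows "of_real \<sigma> * m / (of_real c + w) \<in> cone m"
proof -
  obtain u v where uv: "u \<ge> 0" "v \<ge> 0" and w_eq: "w = of_real u + of_real v * m"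
    using w by (auto simp: cone_def)
  define d where "d = of_real c + w"
  define n where "n = (cmod d)\<^sup>2"
  have "of_real \<sigma> * m / d = of_real \<sigma> * (m * cnj d) / of_real n"
    by (simp add: complex_div_cnj[of _ d] n_def)
  also have "m * cnj d = of_real ((cmod m)\<^sup>2 * v) + of_real (c + u) * m"
    by (simp add: d_def w_eq algebra_simps of_real_power[symmetric] complex_norm_square del: of_real_power)
  finally have "of_real \<sigma> * m / d =
      of_real (\<sigma> * ((cmod m)\<^sup>2 * v) / n) + of_real (\<sigma> * (c + u) / n) * m"
    by (simp add: algebra_simps add_divide_distrib)
  moreover have "\<sigma> * ((cmod m)\<^sup>2 * v) / n \<ge> 0" "\<sigma> * (c + u) / n \<ge> 0"
    using uv assms by (auto simp: n_def)
  ultimately show ?thesis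
    unfolding cone_def d_def[symmetric] by blast
qed

text \<open>The invariant of the recursion for the ratio \<open>\<zeta>\<^sub>M = E\<^sub>M / (\<epsilon>\<^sub>M s\<^sub>M O\<^sub>M) = 1 + w\<close>. The denominator
  \<open>lam\<close> is kept explicit, since its being nonzero is part of what the induction carries along.
  The factor \<open>\<epsilon>\<^sub>M\<close> turns the alternating signs into a constant sign pattern, and \<open>s\<^sub>M\<close> makes the
  recursion depend on the sizes only through \<open>\<sigma> = s\<^sub>M\<^sub>+\<^sub>1 / s\<^sub>M\<close>.\<close>

lemma even_sum_in_cone:
  assumes decr: "\<And>i j. 1 \<le> i \<Longrightarrow> i < j \<Longrightarrow> j \<le> N \<Longrightarrow> r j < r i"
    and pos: "\<And>i. 1 \<le> i \<Longrightarrow> i \<le> N \<Longrightarrow> r i > 0"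
    and y: "\<not> (y \<in> \<real> \<and> Re y > 1)"
    and K: "N \<le> 2 * K + 1"
    and M: "1 \<le> M" "M \<le> N"
  shows "\<exists>w\<in>cone (1 - y). \<exists>lam. lam \<noteq> 0 \<and>
           (- 1) ^ M * of_real (r M ^ 3) * odd_sum r K y M = lam \<and>
           even_sum r K y M = lam * (1 + w)"
  using M
proof (induction M rule: nat_induct_at_least)
  case base
  then have "r 1 \<noteq> 0" using pos[of 1] by simp
  then show ?case
    using even_sum_Suc[of 0 K r y] odd_sum_Suc[of r K y 0] cone_0[of "1 - y"]
    by (auto simp: even_sum_0 odd_sum_0 intro!: bexI[of _ 0])
next
  case (Suc M)
  let ?s = "r M ^ 3" and ?s' = "r (Suc M) ^ 3" and ?m = "1 - y"
  obtain w lam where w: "w \<in> cone ?m" and lam: "lam \<noteq> 0"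
    and odd: "(- 1) ^ M * of_real ?s * odd_sum r K y M = lam"
    and even: "even_sum r K y M = lam * (1 + w)"
    using Suc.IH Suc_leD[OF Suc.prems] by blast
  have spos: "?s > 0" "?s' > 0"
    using pos[of M] pos[of "Suc M"] Suc by auto
  have "?s' < ?s"
    using decr[of M "Suc M"] pos[of "Suc M"] Suc by (intro power_strict_mono) auto
  define \<sigma> where "\<sigma> = ?s' / ?s"
  have \<sigma>: "\<sigma> > 0" "1 - \<sigma> > 0"
    using spos \<open>?s' < ?s\<close> by (auto simp: \<sigma>_def)
  \<comment> \<open>This is \<open>\<zeta>\<^sub>M - \<sigma>\<close>, the factor by which \<open>lam\<close> changes.\<close>
  define d where "d = of_real (1 - \<sigma>) + w"
  have m: "\<not> (?m \<in> \<real> \<and> Re ?m < 0)"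
    using y by (auto simp: complex_is_Real_iff)
  have d0: "d \<noteq> 0"
    unfolding d_def by (rule pos_plus_cone_nonzero[OF m w]) (use \<sigma> in auto)
  have odd': "(- 1) ^ M * of_real ?s' * odd_sum r K y M = of_real \<sigma> * lam"
    using spos by (simp add: odd[symmetric] \<sigma>_def)
  have "(- 1) ^ Suc M * of_real ?s' * odd_sum r K y (Suc M)
      = even_sum r K y M - (- 1) ^ M * of_real ?s' * odd_sum r K y M"
    using pos[of "Suc M"] Suc by (simp add: odd_sum_Suc algebra_simps)
  also have "\<dots> = lam * d"
    unfolding odd' even by (simp add: d_def algebra_simps)
  finally have 1: "(- 1) ^ Suc M * of_real ?s' * odd_sum r K y (Suc M) = lam * d" .
  have "even_sum r K y (Suc M) = even_sum r K y M - y * ((- 1) ^ M * of_real ?s' * odd_sum r K y M)"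
    using Suc K by (simp add: even_sum_Suc algebra_simps)
  also have "\<dots> = lam * (d + of_real \<sigma> * ?m)"
    unfolding odd' even by (simp add: d_def algebra_simps)
  also have "\<dots> = lam * d * (1 + of_real \<sigma> * ?m / d)"
    using d0 by (simp add: field_simps)
  finally have 2: "even_sum r K y (Suc M) = lam * d * (1 + of_real \<sigma> * ?m / d)" .
  have "of_real \<sigma> * ?m / d \<in> cone ?m"
    unfolding d_def by (rule cone_inversion[OF w]) (use \<sigma> in auto)
  with 1 2 lam d0 show ?case by (metis mult_eq_0_iff)
qed


section \<open>From the complex roots to the real polynomial\<close>

lemma degree_f_poly: "degree (f_poly r N) = N div 2"
  and coeff_f_poly: "i \<le> N div 2 \<Longrightarrow>
    coeff (f_poly r N) i = 2 ^ (N div 2 - i) * f_coeff r N (N div 2 - i)"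
proof -
  show c: "coeff (f_poly r N) i = 2 ^ (N div 2 - i) * f_coeff r N (N div 2 - i)"
    if "i \<le> N div 2" for i
  proof -
    have "coeff (f_poly r N) i =
        (\<Sum>k\<in>{0..N div 2}. if N div 2 - i = k then 2 ^ k * f_coeff r N k else 0)"
      unfolding f_poly_def coeff_sum coeff_monom using that by (intro sum.cong) auto
    then show ?thesis by simp
  qed
  show "degree (f_poly r N) = N div 2"
  proof (rule antisym)
    show "degree (f_poly r N) \<le> N div 2"
      unfolding f_poly_def
      by (intro degree_sum_le) (auto intro: order.trans[OF degree_monom_le])
    show "N div 2 \<le> degree (f_poly r N)"
      using c[of "N div 2"] by (intro le_degree) (simp add: f_coeff_0)
  qed
qed

text \<open>The factor \<open>2 ^ k\<close> in \<open>f_poly\<close> is absorbed by evaluating the generating function at \<open>2 / q\<close>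
  instead of \<open>1 / q\<close>.\<close>

lemma poly_f_poly_eq_even_sum:
  assumes "q \<noteq> 0"
  shows "poly (map_poly of_real (f_poly r N)) q = q ^ (N div 2) * even_sum r (N div 2) (2 / q) N"
proof -
  let ?K = "N div 2"
  have "poly (map_poly of_real (f_poly r N)) q =
      (\<Sum>i\<le>?K. of_real (coeff (f_poly r N) i) * q ^ i)"
    by (simp add: poly_altdef coeff_map_poly degree_map_poly degree_f_poly)
  also have "\<dots> = (\<Sum>i\<le>?K. of_real (2 ^ (?K - i) * f_coeff r N (?K - i)) * q ^ i)"
    by (intro sum.cong) (auto simp: coeff_f_poly)
  also have "\<dots> = (\<Sum>k\<le>?K. of_real (2 ^ k * f_coeff r N k) * q ^ (?K - k))"
    by (rule sum.reindex_bij_witness[of _ "\<lambda>k. ?K - k" "\<lambda>k. ?K - k"]) auto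
  also have "\<dots> = q ^ ?K * even_sum r ?K (2 / q) N"
    unfolding even_sum_def sum_distrib_left
    using assms by (intro sum.cong) (auto simp: power_diff power_divide)
  finally show ?thesis .
qed

lemma f_poly_complex_root:
  assumes "N \<ge> 1"
    and decr: "\<And>i j. 1 \<le> i \<Longrightarrow> i < j \<Longrightarrow> j \<le> N \<Longrightarrow> r i > r j"
    and rN: "r N > 0"
    and root: "poly (map_poly of_real (f_poly r N)) q = (0 :: complex)"
  shows "q \<in> \<real> \<and> Re q \<in> {0..<2}"
proof (cases "q = 0")
  case False
  have pos: "r i > 0" if "1 \<le> i" "i \<le> N" for i
    using decr[of i N] rN that by (cases "i = N") auto
  have "2 / q \<in> \<real> \<and> Re (2 / q) > 1"
  proof (rule ccontr)
    assume y: "\<not> (2 / q \<in> \<real> \<and> Re (2 / q) > 1)"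
    have "N \<le> 2 * (N div 2) + 1" by simp
    then obtain w lam where w: "w \<in> cone (1 - 2 / q)" and lam: "lam \<noteq> 0"
      and eq: "even_sum r (N div 2) (2 / q) N = lam * (1 + w)"
      using even_sum_in_cone[of N r "2 / q" "N div 2" N, OF decr pos y] \<open>N \<ge> 1\<close>
      by blast
    have "\<not> (1 - 2 / q \<in> \<real> \<and> Re (1 - 2 / q) < 0)"
      using y by (auto simp: complex_is_Real_iff)
    from pos_plus_cone_nonzero[OF this w, of 1] lam eq
    have "even_sum r (N div 2) (2 / q) N \<noteq> 0" by simp
    with root poly_f_poly_eq_even_sum[OF False] False show False by simp
  qed
  then obtain t where t: "2 / q = of_real t" "t > 1"
    by (metis Reals_cases Re_complex_of_real)
  then have "q = of_real (2 / t)"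
    using False by (auto simp: field_simps)
  with t show ?thesis by (simp add: divide_less_eq)
qed auto

lemma poly_map_poly_of_real:
  "poly (map_poly complex_of_real p) (of_real x) = of_real (poly p x)"
  by (induction p) (auto simp: map_poly_pCons)

text \<open>The fundamental theorem of algebra supplies a complex root; being real, it splits off a linear
  factor over the reals, and the cofactor inherits the hypothesis.\<close>

lemma size_proots_eq_degree:
  fixes p :: "real poly"
  assumes "p \<noteq> 0" and "\<And>z. poly (map_poly complex_of_real p) z = 0 \<Longrightarrow> z \<in> \<real>"
  shows "size (proots p) = degree p"
  using assms
proof (induction "degree p" arbitrary: p)
  case 0
  then obtain c where "p = [:c:]" by (metis degree_eq_zeroE)
  then show ?case using 0 by simp
next
  case (Suc n)
  have "\<not> constant (poly (map_poly complex_of_real p))"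
    using Suc.hyps(2) by (simp add: constant_degree degree_map_poly)
  then obtain z where z: "poly (map_poly complex_of_real p) z = 0"
    using fundamental_theorem_of_algebra by blast
  with Suc.prems obtain a where "z = of_real a"
    by (metis Reals_cases)
  with z have "poly p a = 0"
    by (simp add: poly_map_poly_of_real)
  then obtain q where p: "p = [:- a, 1:] * q"
    by (metis dvdE poly_eq_0_iff_dvd)
  with Suc.prems have q: "q \<noteq> 0" by auto
  with p Suc.hyps(2) have deg: "n = degree q" by (simp add: degree_mult_eq del: mult_pCons_left)
  have "map_poly complex_of_real p =
      map_poly complex_of_real [:- a, 1:] * map_poly complex_of_real q"
    unfolding p by (rule poly_eqI) (simp add: coeff_map_poly coeff_mult del: mult_pCons_left)
  then have "size (proots q) = degree q"
    using Suc.prems by (intro Suc.hyps(1) deg q) auto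
  with p q Suc.hyps(2) deg show ?case
    by (simp add: proots_mult del: mult_pCons_left)
qed

theorem theorem2p3:
  fixes N :: nat and r :: "nat \<Rightarrow> real"
  assumes "N \<ge> 1"
    and "\<And>i j. 1 \<le> i \<Longrightarrow> i < j \<Longrightarrow> j \<le> N \<Longrightarrow> r i > r j"
    and "r N > 0"
  shows "size (proots (f_poly r N)) = N div 2 \<and>
         (\<forall>q. poly (f_poly r N) q = 0 \<longrightarrow> q \<in> {- 1 / 4..2})"
proof (intro conjI allI impI)
  have root: "z \<in> \<real> \<and> Re z \<in> {0..<2}" if "poly (map_poly of_real (f_poly r N)) z = 0" for z
    using f_poly_complex_root[of N r z] assms that by blast
  have "f_poly r N \<noteq> 0"
    using coeff_f_poly[of "N div 2" N r] by (auto simp: f_coeff_0)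
  then show "size (proots (f_poly r N)) = N div 2"
    using size_proots_eq_degree[of "f_poly r N"] root by (auto simp: degree_f_poly)
  fix q :: real
  assume "poly (f_poly r N) q = 0"
  then have "poly (map_poly complex_of_real (f_poly r N)) (of_real q) = 0"
    by (simp add: poly_map_poly_of_real)
  from root[OF this] show "q \<in> {- 1 / 4..2}"
    by simp
qed

end
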